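(* For each positive integer $n$, let $Q_{2^{n+1}}$ denote the generalised quaternion group of order $2^{n+1}$ and let $D_{2\cdot 2^n}$ denote the dihedral group of the same order $2^{n+1}$. Then the graphs $\mathrm{Pow}(Q_{2^{n+1}})$ and $\mathrm{Com}(D_{2\cdot 2^n})$ are isomorphic: $\mathrm{Pow}(Q_{2^{n+1}}) \cong \mathrm{Com}(D_{2\cdot 2^n})$.
   Context: All graphs are undirected, without loops or multiple edges. For a finite group $G$, the power graph $\mathrm{Pow}(G)$ is the graph with vertex set $G$ in which two distinct vertices $x,y$ are adjacent if and only if $x=y^k$ or $y=x^k$ for some integer $k$. The commuting graph $\mathrm{Com}(G)$ is the graph with vertex set $G$ in which two distinct vertices $x,y$ are adjacent if and only if $xy=yx$. The generalised quaternion group of order $2^{n+1}$ is $$Q_{2^{n+1}} = \langle h,x \mid h^{2^n}=e,\ x^2=h^{2^{n-1}},\ x^{-1}hx=h^{-1}\rangle.$$ The dihedral group of order $2^{n+1}$ is $$D_{2\cdot 2^n} = \langle a,b \mid a^{2^n}=b^2=e,\ bab=a^{-1}\rangle.$$ Here $e$ denotes the identity element. *)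

theory Defs
  imports
    "HOL-Algebra.Group"
    "Graph_Theory.Digraph_Isomorphism"
    "Graph_Theory.Pair_Digraph"
begin

section \<open>Groups given by generators and relations\<close>

text \<open>A letter \<open>(s, True)\<close> stands for the generator \<open>s\<close>, a letter \<open>(s, False)\<close> for its formal
  inverse. All elements of the type \<open>'g\<close> are generators, and a pair \<open>(u, v)\<close> of words in
  the set \<open>R\<close> is the defining relation \<open>u = v\<close>.\<close>

type_synonym 'g word = "('g \<times> bool) list"

abbreviation gen_pow :: "'g \<Rightarrow> nat \<Rightarrow> 'g word" where
  "gen_pow s k \<equiv> replicate k (s, True)"

abbreviation gen :: "'g \<Rightarrow> 'g word" where
  "gen s \<equiv> [(s, True)]"

abbreviation gen_inv :: "'g \<Rightarrow> 'g word" where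
  "gen_inv s \<equiv> [(s, False)]"

inductive word_eq :: "('g word \<times> 'g word) set \<Rightarrow> 'g word \<Rightarrow> 'g word \<Rightarrow> bool"
  for R :: "('g word \<times> 'g word) set" where
  relation: "(u, v) \<in> R \<Longrightarrow> word_eq R u v"
| cancel: "word_eq R [(s, b), (s, \<not> b)] []"
| append: "word_eq R u u' \<Longrightarrow> word_eq R v v' \<Longrightarrow> word_eq R (u @ v) (u' @ v')"
| refl: "word_eq R u u"
| sym: "word_eq R u v \<Longrightarrow> word_eq R v u"
| trans: "word_eq R u v \<Longrightarrow> word_eq R v w \<Longrightarrow> word_eq R u w"

definition word_class :: "('g word \<times> 'g word) set \<Rightarrow> 'g word \<Rightarrow> 'g word set" where
  "word_class R u = {v. word_eq R u v}"

definition presented_group :: "('g word \<times> 'g word) set \<Rightarrow> 'g word set monoid" where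
  "presented_group R =
    \<lparr>carrier = range (word_class R),
     monoid.mult = (\<lambda>A B. \<Union>u\<in>A. \<Union>v\<in>B. word_class R (u @ v)),
     monoid.one = word_class R []\<rparr>"

lemma word_class_eq_iff: "word_class R u = word_class R v \<longleftrightarrow> word_eq R u v"
proof
  assume "word_class R u = word_class R v"
  moreover have "v \<in> word_class R v"
    by (simp add: word_class_def word_eq.refl)
  ultimately show "word_eq R u v"
    by (simp add: word_class_def set_eq_iff)
next
  assume "word_eq R u v"
  then show "word_class R u = word_class R v"
    unfolding word_class_def
    by (intro Collect_cong iffI) (erule (1) word_eq.trans[OF word_eq.sym] word_eq.trans)+
qed

lemma presented_group_mult:
  "word_class R u \<otimes>\<^bsub>presented_group R\<^esub> word_class R v = word_class R (u @ v)"
proof -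
  have "word_class R (u' @ v') = word_class R (u @ v)"
    if "u' \<in> word_class R u" "v' \<in> word_class R v" for u' v'
    unfolding word_class_eq_iff
    by (rule word_eq.sym, rule word_eq.append) (use that in \<open>simp_all add: word_class_def\<close>)
  moreover have "u \<in> word_class R u" "v \<in> word_class R v"
    by (auto simp: word_class_def intro: word_eq.refl)
  ultimately have "(\<Union>u'\<in>word_class R u. \<Union>v'\<in>word_class R v. word_class R (u' @ v')) =
      word_class R (u @ v)"
    by blast
  then show ?thesis
    by (simp add: presented_group_def)
qed

lemma word_eq_inverse: "word_eq R (map (\<lambda>(s, b). (s, \<not> b)) (rev u) @ u) []"
proof (induction u)
  case Nil
  show ?case by (simp add: word_eq.refl)
next
  case (Cons a u)
  obtain s b where a: "a = (s, b)" by (cases a)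
  let ?i = "map (\<lambda>(s, b). (s, \<not> b)) (rev u)"
  have "word_eq R [(s, \<not> b), (s, b)] []"
    using word_eq.cancel[of R s "\<not> b"] by simp
  then have "word_eq R (?i @ [(s, \<not> b), (s, b)] @ u) (?i @ [] @ u)"
    by (intro word_eq.append word_eq.refl)
  then have "word_eq R (?i @ [(s, \<not> b), (s, b)] @ u) []"
    by (rule word_eq.trans) (simp add: Cons.IH)
  then show ?case
    by (simp add: a)
qed

lemma group_presented_group: "group (presented_group R)"
proof (rule groupI)
  note [simp] = presented_group_mult
  have carrier: "carrier (presented_group R) = range (word_class R)"
    and one: "\<one>\<^bsub>presented_group R\<^esub> = word_class R []"
    by (simp_all add: presented_group_def)
  fix x y z
  assume "x \<in> carrier (presented_group R)"
  then obtain u where x: "x = word_class R u" by (auto simp: carrier)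
  show "\<one>\<^bsub>presented_group R\<^esub> \<otimes>\<^bsub>presented_group R\<^esub> x = x"
    by (simp add: x one)
  show "\<exists>y\<in>carrier (presented_group R). y \<otimes>\<^bsub>presented_group R\<^esub> x = \<one>\<^bsub>presented_group R\<^esub>"
    unfolding carrier one x using word_eq_inverse[of R u]
    by (auto simp: word_class_eq_iff intro!: exI[of _ "map (\<lambda>(s, b). (s, \<not> b)) (rev u)"])
  assume "y \<in> carrier (presented_group R)"
  then obtain v where y: "y = word_class R v" by (auto simp: carrier)
  show "x \<otimes>\<^bsub>presented_group R\<^esub> y \<in> carrier (presented_group R)"
    by (simp add: x y carrier)
  assume "z \<in> carrier (presented_group R)"
  then obtain w where z: "z = word_class R w" by (auto simp: carrier)
  show "x \<otimes>\<^bsub>presented_group R\<^esub> y \<otimes>\<^bsub>presented_group R\<^esub> z =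
      x \<otimes>\<^bsub>presented_group R\<^esub> (y \<otimes>\<^bsub>presented_group R\<^esub> z)"
    by (simp add: x y z)
qed (simp add: presented_group_def)


section \<open>Generalised quaternion and dihedral groups\<close>

datatype quaternion_gen = Gen_h | Gen_x

text \<open>The argument \<open>n\<close> gives the group of order \<open>2 ^ (n + 1)\<close>. It is meant to be positive,
  as the exponent \<open>n - 1\<close> is a truncated subtraction.\<close>

definition gen_quaternion_group :: "nat \<Rightarrow> quaternion_gen word set monoid" where
  "gen_quaternion_group n = presented_group
    {(gen_pow Gen_h (2 ^ n), []),
     (gen_pow Gen_x 2, gen_pow Gen_h (2 ^ (n - 1))),
     (gen_inv Gen_x @ gen Gen_h @ gen Gen_x, gen_inv Gen_h)}"

datatype dihedral_gen = Gen_a | Gen_b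

text \<open>The argument \<open>m\<close> is the order of the rotation subgroup, so the group has order \<open>2 * m\<close>.\<close>

definition dihedral_group :: "nat \<Rightarrow> dihedral_gen word set monoid" where
  "dihedral_group m = presented_group
    {(gen_pow Gen_a m, []),
     (gen_pow Gen_b 2, []),
     (gen Gen_b @ gen Gen_a @ gen Gen_b, gen_inv Gen_a)}"


section \<open>Power graphs and commuting graphs\<close>

text \<open>An undirected graph without loops or multiple edges is represented as a loop-free
  symmetric digraph, each edge being a pair of opposite arcs.\<close>

definition power_graph :: "('a, 'b) monoid_scheme \<Rightarrow> 'a pair_pre_digraph" where
  "power_graph G =
    \<lparr>pverts = carrier G,
     parcs = {(x, y). x \<in> carrier G \<and> y \<in> carrier G \<and> x \<noteq> y \<and>
       (\<exists>k::int. x = y [^]\<^bsub>G\<^esub> k \<or> y = x [^]\<^bsub>G\<^esub> k)}\<rparr>"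

definition commuting_graph :: "('a, 'b) monoid_scheme \<Rightarrow> 'a pair_pre_digraph" where
  "commuting_graph G =
    \<lparr>pverts = carrier G,
     parcs = {(x, y). x \<in> carrier G \<and> y \<in> carrier G \<and> x \<noteq> y \<and>
       x \<otimes>\<^bsub>G\<^esub> y = y \<otimes>\<^bsub>G\<^esub> x}\<rparr>"

lemma pair_bidirected_digraph_power_graph: "pair_bidirected_digraph (power_graph G)"
  by unfold_locales
    (auto simp: power_graph_def symmetric_def arcs_ends_conv intro!: symI)

lemma pair_bidirected_digraph_commuting_graph: "pair_bidirected_digraph (commuting_graph G)"
  by unfold_locales
    (auto simp: commuting_graph_def symmetric_def arcs_ends_conv intro!: symI)

text \<open>For such graphs the library's notion of isomorphism, which maps vertices and arcs
  separately, amounts to a bijection of the vertices preserving adjacency both ways.\<close>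

lemma digraph_iso_with_proj_iff:
  assumes "pair_wf_digraph G" and "pair_wf_digraph H"
  shows "digraph_iso (with_proj G) (with_proj H) \<longleftrightarrow>
    (\<exists>f. bij_betw f (pverts G) (pverts H) \<and>
      (\<forall>u\<in>pverts G. \<forall>v\<in>pverts G. (u, v) \<in> parcs G \<longleftrightarrow> (f u, f v) \<in> parcs H))"
proof
  interpret G: pair_wf_digraph G by fact
  assume "digraph_iso (with_proj G) (with_proj H)"
  then obtain i where i: "pre_digraph.digraph_isomorphism (with_proj G) i"
      "with_proj H = app_iso i (with_proj G)"
    by (auto simp: digraph_iso_def)
  have H: "pverts H = iso_verts i ` pverts G" "parcs H = iso_arcs i ` parcs G"
      "iso_tail i = fst" "iso_head i = snd"
    using i(2) by (auto simp: with_proj_def app_iso_def)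
  have inj: "inj_on (iso_verts i) (pverts G)"
    using i(1) by (simp add: pre_digraph.digraph_isomorphism_def)
  have arcs: "iso_arcs i (u, v) = (iso_verts i u, iso_verts i v)" if "(u, v) \<in> parcs G" for u v
    using i(1) that H(3,4) by (fastforce simp: pre_digraph.digraph_isomorphism_def prod_eq_iff)
  have "(u, v) \<in> parcs G \<longleftrightarrow> (iso_verts i u, iso_verts i v) \<in> parcs H"
    if uv: "u \<in> pverts G" "v \<in> pverts G" for u v
  proof
    assume "(u, v) \<in> parcs G"
    then show "(iso_verts i u, iso_verts i v) \<in> parcs H"
      using arcs H(2) by (metis imageI)
  next
    assume "(iso_verts i u, iso_verts i v) \<in> parcs H"
    then obtain u' v' where e: "(u', v') \<in> parcs G"
        "iso_arcs i (u', v') = (iso_verts i u, iso_verts i v)"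
      using H(2) by auto
    then have "u' = u" "v' = v"
      using arcs[OF e(1)] uv G.wellformed'[OF e(1)] inj by (auto dest: inj_onD)
    then show "(u, v) \<in> parcs G" using e(1) by simp
  qed
  then show "\<exists>f. bij_betw f (pverts G) (pverts H) \<and>
      (\<forall>u\<in>pverts G. \<forall>v\<in>pverts G. (u, v) \<in> parcs G \<longleftrightarrow> (f u, f v) \<in> parcs H)"
    using inj H(1) by (auto simp: bij_betw_def intro!: exI[of _ "iso_verts i"])
next
  interpret G: pair_wf_digraph G by fact
  interpret H: pair_wf_digraph H by fact
  assume "\<exists>f. bij_betw f (pverts G) (pverts H) \<and>
      (\<forall>u\<in>pverts G. \<forall>v\<in>pverts G. (u, v) \<in> parcs G \<longleftrightarrow> (f u, f v) \<in> parcs H)"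
  then obtain f where f: "inj_on f (pverts G)" "f ` pverts G = pverts H"
      "\<And>u v. u \<in> pverts G \<Longrightarrow> v \<in> pverts G \<Longrightarrow> (u, v) \<in> parcs G \<longleftrightarrow> (f u, f v) \<in> parcs H"
    by (auto simp: bij_betw_def)
  let ?i = "\<lparr>iso_verts = f, iso_arcs = map_prod f f, iso_head = snd, iso_tail = fst\<rparr>"
  have sub: "parcs G \<subseteq> pverts G \<times> pverts G" using G.wellformed' by auto
  have "inj_on (map_prod f f) (parcs G)"
    using map_prod_inj_on[OF f(1) f(1)] sub by (rule inj_on_subset)
  then have "pre_digraph.digraph_isomorphism (with_proj G) ?i"
    using f(1) G.wf_digraph by (auto simp: pre_digraph.digraph_isomorphism_def)
  moreover have "map_prod f f ` parcs G = parcs H"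
  proof (intro equalityI subsetI)
    fix e assume "e \<in> map_prod f f ` parcs G"
    then show "e \<in> parcs H" using sub f(3) by auto
  next
    fix e assume e: "e \<in> parcs H"
    obtain a b where ab: "e = (a, b)" by (cases e)
    then obtain u v where "u \<in> pverts G" "a = f u" "v \<in> pverts G" "b = f v"
      using H.wellformed' e f(2) by (metis imageE)
    then show "e \<in> map_prod f f ` parcs G" using f(3) e ab by force
  qed
  ultimately show "digraph_iso (with_proj G) (with_proj H)"
    using f(2) by (auto simp: digraph_iso_def with_proj_def app_iso_def intro!: exI[of _ ?i])
qed

end

theory Submission
  imports Defs "HOL-Number_Theory.Cong"
begin

text \<open>The relations of either group let every element be written as \<open>r\<^sup>i s\<^sup>e\<close> with
  \<open>0 \<le> i < 2\<^sup>n\<close> and \<open>e \<in> {0, 1}\<close>, and multiplication differs only in \<open>s\<^sup>2 = r\<^sup>c\<close>, where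
  \<open>c\<close> is \<open>2\<^bsup>n-1\<^esup>\<close> for the quaternion group and \<open>0\<close> for the dihedral group. Matching equal
  normal forms is the graph isomorphism: the powers of \<open>r\<close> form a clique on both sides, because
  they commute, and because of any two elements of a cyclic 2-group one is a power of the other;
  a quaternion element \<open>q = r\<^sup>j s\<close> has exactly the powers \<open>1, r\<^bsup>2^(n-1)\<^esup>, q, q\<inverse>\<close>, which correspond
  to what the dihedral element \<open>r\<^sup>j s\<close> commutes with.\<close>

subsection \<open>Groups given by generators and relations\<close>

primrec word_value :: "('a, 'b) monoid_scheme \<Rightarrow> ('g \<Rightarrow> 'a) \<Rightarrow> 'g word \<Rightarrow> 'a" where
  "word_value H g [] = \<one>\<^bsub>H\<^esub>"
| "word_value H g (l # w) =
    (if snd l then g (fst l) else inv\<^bsub>H\<^esub> g (fst l)) \<otimes>\<^bsub>H\<^esub> word_value H g w"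

context group
begin

lemma word_value_closed: "range g \<subseteq> carrier G \<Longrightarrow> word_value G g w \<in> carrier G"
  by (induction w) auto

lemma word_value_append:
  assumes "range g \<subseteq> carrier G"
  shows "word_value G g (u @ v) = word_value G g u \<otimes> word_value G g v"
proof (induction u)
  case Nil
  show ?case using word_value_closed[OF assms] by simp
next
  case (Cons l u)
  have "g (fst l) \<in> carrier G" using assms by auto
  then show ?case using Cons word_value_closed[OF assms] by (simp add: m_assoc)
qed

lemma word_value_gen_pow:
  assumes "range g \<subseteq> carrier G"
  shows "word_value G g (gen_pow s k) = g s [^] k"
proof (induction k)
  case (Suc k)
  have "g s \<in> carrier G" using assms by auto
  then show ?case using Suc nat_pow_mult[of "g s" 1 k] by simp
qed simp

text \<open>Induction on the derivation of the equality: values respect concatenation, and inverse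
  letters cancel in any group, which leaves only the defining relations to check.\<close>

lemma word_value_word_eq:
  assumes g: "range g \<subseteq> carrier G"
    and R: "\<And>u v. (u, v) \<in> R \<Longrightarrow> word_value G g u = word_value G g v"
    and "word_eq R u v"
  shows "word_value G g u = word_value G g v"
  using assms(3)
proof (induction rule: word_eq.induct)
  case (cancel s b)
  have "g s \<in> carrier G" using g by auto
  then show ?case by auto
qed (simp_all add: R word_value_append[OF g])

text \<open>Von Dyck's theorem, the universal property of a presentation.\<close>

lemma hom_from_presented_group:
  assumes g: "range g \<subseteq> carrier G"
    and R: "\<And>u v. (u, v) \<in> R \<Longrightarrow> word_value G g u = word_value G g v"
  obtains f where "f \<in> hom (presented_group R) G"
    "\<And>u. f (word_class R u) = word_value G g u"
proof
  \<comment> \<open>Any representative would do, since by \<open>word_value_word_eq\<close> the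
    value is constant on the class.\<close>
  define f where "f A = word_value G g (SOME u. A = word_class R u)" for A
  show f: "f (word_class R u) = word_value G g u" for u
  proof -
    have "word_class R u = word_class R (SOME v. word_class R u = word_class R v)"
      by (rule someI) (rule HOL.refl)
    then show ?thesis
      unfolding f_def word_class_eq_iff using word_value_word_eq[OF g R] by metis
  qed
  show "f \<in> hom (presented_group R) G"
    by (rule homI)
      (auto simp: presented_group_def[of R, THEN arg_cong[where f = carrier]] presented_group_mult
        f word_value_closed[OF g] word_value_append[OF g])
qed

end

lemma carrier_presented_group: "carrier (presented_group R) = range (word_class R)"
  by (simp add: presented_group_def)

text \<open>With this, each defining relation becomes an equation between the classes of the
  generators, so that group algebra replaces the manipulation of words. It rests on the cancellation
  rule, which makes the class of a formal inverse the inverse in the group.\<close>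

lemma word_class_eq_word_value:
  "word_class R u = word_value (presented_group R) (\<lambda>s. word_class R (gen s)) u"
proof (induction u)
  case Nil
  show ?case by (simp add: presented_group_def)
next
  case (Cons l u)
  interpret group "presented_group R" by (rule group_presented_group)
  obtain s b where l: "l = (s, b)" by (cases l)
  have "word_eq R (gen_inv s @ gen s) []"
    using word_eq.cancel[of R s False] by simp
  then have "word_class R (gen_inv s) \<otimes>\<^bsub>presented_group R\<^esub> word_class R (gen s) =
      \<one>\<^bsub>presented_group R\<^esub>"
    unfolding presented_group_mult word_class_eq_iff[symmetric] by (simp add: presented_group_def)
  then have inv: "inv\<^bsub>presented_group R\<^esub> word_class R (gen s) = word_class R (gen_inv s)"
    by (intro inv_equality) (auto simp: carrier_presented_group)
  have "word_class R (l # u) = word_class R [l] \<otimes>\<^bsub>presented_group R\<^esub> word_class R u"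
    by (simp add: presented_group_mult)
  with Cons inv show ?case by (cases b) (simp_all add: l)
qed

subsection \<open>Extensions of a cyclic group by an inverting element\<close>

text \<open>The pair \<open>(i, e)\<close> stands for \<open>r\<^sup>i s\<^sup>e\<close>, where \<open>r\<close> has order \<open>m\<close>,
  \<open>s\<^sup>2 = r\<^sup>c\<close> and \<open>s r s\<inverse> = r\<inverse>\<close>.\<close>

definition inverting_extension :: "int \<Rightarrow> int \<Rightarrow> (int \<times> bool) monoid" where
  "inverting_extension m c =
    \<lparr>carrier = {0..<m} \<times> UNIV,
     monoid.mult = (\<lambda>(i, d) (j, e).
       ((i + (if d then - j else j) + (if d \<and> e then c else 0)) mod m, d \<noteq> e)),
     monoid.one = (0, False)\<rparr>"

lemma inverting_extension_simps:
  "carrier (inverting_extension m c) = {0..<m} \<times> UNIV"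
  "\<one>\<^bsub>inverting_extension m c\<^esub> = (0, False)"
  "(i, d) \<otimes>\<^bsub>inverting_extension m c\<^esub> (j, e) =
    ((i + (if d then - j else j) + (if d \<and> e then c else 0)) mod m, d \<noteq> e)"
  by (simp_all add: inverting_extension_def)

text \<open>These remove the inner reductions modulo \<open>m\<close> from the three-term sums that
  nested products in the extension produce.\<close>

lemma mod_summand_simps:
  fixes a b d m :: int
  shows "(a mod m + b + d) mod m = (a + b + d) mod m"
    "(a mod m - b + d) mod m = (a - b + d) mod m"
    "(a + b mod m + d) mod m = (a + b + d) mod m"
    "(a - b mod m + d) mod m = (a - b + d) mod m"
  using mod_add_left_eq[of a m "b + d"] mod_add_left_eq[of a m "d - b"]
    mod_add_left_eq[of b m "a + d"] mod_diff_right_eq[of "a + d" b m]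
  by (simp_all add: algebra_simps)

text \<open>The divisibility is forced: \<open>s\<close> inverts \<open>r^c\<close>, yet commutes
  with it because \<open>r^c\<close> is the square of \<open>s\<close>, so
  \<open>r^(2c) = 1\<close>.\<close>

locale inverting_extension_params =
  fixes m c :: int
  assumes m_pos: "m > 0" and m_dvd: "m dvd 2 * c"
begin

abbreviation M :: "(int \<times> bool) monoid" where "M \<equiv> inverting_extension m c"

lemmas M_simps = inverting_extension_simps[of m c]

sublocale group M
proof (rule groupI)
  note [simp] = M_simps
  fix x y z assume x: "x \<in> carrier M" and y: "y \<in> carrier M" and z: "z \<in> carrier M"
  show "x \<otimes>\<^bsub>M\<^esub> y \<in> carrier M"
    using m_pos by (cases x; cases y) auto
  obtain i d j e k f where [simp]: "x = (i, d)" "y = (j, e)" "z = (k, f)"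
    by (cases x; cases y; cases z)
  obtain q where q: "2 * c = m * q" using m_dvd by (auto elim: dvdE)
  \<comment> \<open>The two bracketings differ only for three reflections, where one yields
    \<open>+ c\<close> and the other \<open>- c\<close>.\<close>
  have "(a + c) mod m = (a - c) mod m" for a
    using q by (simp add: mod_eq_dvd_iff)
  from this[of "i - j + k"] show "x \<otimes>\<^bsub>M\<^esub> y \<otimes>\<^bsub>M\<^esub> z = x \<otimes>\<^bsub>M\<^esub> (y \<otimes>\<^bsub>M\<^esub> z)"
    by (auto simp: mod_summand_simps mod_simps) (auto simp: algebra_simps)
next
  fix x assume x: "x \<in> carrier M"
  obtain i d where [simp]: "x = (i, d)" by (cases x)
  show "\<one>\<^bsub>M\<^esub> \<otimes>\<^bsub>M\<^esub> x = x" using x by (simp add: M_simps)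
  \<comment> \<open>A product \<open>(k, True)\<close> times \<open>(i, True)\<close> has first
    component \<open>k - i + c\<close>, so a reflection is inverted by
    \<open>k = i - c\<close>.\<close>
  have "(if d then ((i - c) mod m, True) else ((- i) mod m, False)) \<in> carrier M"
    using m_pos by (simp add: M_simps)
  moreover have "(if d then ((i - c) mod m, True) else ((- i) mod m, False)) \<otimes>\<^bsub>M\<^esub> x = \<one>\<^bsub>M\<^esub>"
    by (simp add: M_simps mod_simps mod_summand_simps)
  ultimately show "\<exists>y\<in>carrier M. y \<otimes>\<^bsub>M\<^esub> x = \<one>\<^bsub>M\<^esub>" by blast
qed (use m_pos in \<open>simp add: M_simps\<close>)

lemma inv_rotation: "inv\<^bsub>M\<^esub> (i mod m, False) = ((- i) mod m, False)"
  by (rule inv_equality) (use m_pos in \<open>simp_all add: M_simps mod_simps\<close>)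

lemma int_pow_rotation: "(i mod m, False) [^]\<^bsub>M\<^esub> (k::int) = ((k * i) mod m, False)"
proof (induction k rule: int_induct[where k = 0])
  case base
  show ?case by (simp add: M_simps)
next
  case (step1 k)
  have "(i mod m, False) \<in> carrier M" using m_pos by (simp add: M_simps)
  then show ?case
    using step1 by (simp add: int_pow_mult M_simps mod_simps algebra_simps)
next
  case (step2 k)
  have "(i mod m, False) \<in> carrier M" using m_pos by (simp add: M_simps)
  then show ?case
    using step2 by (simp add: int_pow_diff inv_rotation M_simps mod_simps algebra_simps)
qed

text \<open>All reflections have the same square: in \<open>j - j + c\<close> the index
  \<open>j\<close> drops out. Hence even powers do not depend on \<open>j\<close>.\<close>

lemma int_pow_reflection:
  assumes "(j, True) \<in> carrier M"
  shows "(j, True) [^]\<^bsub>M\<^esub> (2 * k :: int) = ((k * c) mod m, False)"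
    and "(j, True) [^]\<^bsub>M\<^esub> (2 * k + 1 :: int) = ((k * c + j) mod m, True)"
proof -
  have "(j, True) [^]\<^bsub>M\<^esub> (2::int) = (j, True) [^]\<^bsub>M\<^esub> (1 + 1::int)" by simp
  also have "\<dots> = (c mod m, False)"
    using assms by (subst int_pow_mult) (simp_all add: M_simps del: one_add_one)
  finally show *: "(j, True) [^]\<^bsub>M\<^esub> (2 * k) = ((k * c) mod m, False)"
    using int_pow_pow[OF assms, of 2 k] int_pow_rotation[of c k] by simp
  show "(j, True) [^]\<^bsub>M\<^esub> (2 * k + 1 :: int) = ((k * c + j) mod m, True)"
    using assms by (simp add: int_pow_mult * M_simps mod_simps)
qed

end

text \<open>The inverting relation in an arbitrary group, with nothing assumed about the orders of
  the elements. It therefore applies to a presented group before its size is known.\<close>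

locale inverted_element = group +
  fixes r s :: 'a
  assumes r_closed [simp]: "r \<in> carrier G" and s_closed [simp]: "s \<in> carrier G"
    and s_r: "s \<otimes> r = inv r \<otimes> s"
begin

lemma s_int_pow: "s \<otimes> r [^] (k::int) = r [^] (- k) \<otimes> s"
proof (induction k rule: int_induct[where k = 0])
  case base
  show ?case by simp
next
  case (step1 k)
  have "s \<otimes> r [^] (k + 1) = r [^] (- k) \<otimes> (s \<otimes> r)"
    using step1 by (simp add: int_pow_mult flip: m_assoc)
  also have "\<dots> = r [^] (- k - 1) \<otimes> s"
    by (simp add: s_r int_pow_diff m_assoc)
  finally show ?case by simp
next
  case (step2 k)
  \<comment> \<open>The downward step of the induction needs the relation for \<open>inv r\<close>,
    which follows by solving the given one for \<open>s\<close>.\<close>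
  have "s = r \<otimes> (s \<otimes> r)"
    by (simp add: s_r flip: m_assoc)
  then have s_inv: "s \<otimes> inv r = r \<otimes> s"
    by (metis inv_closed m_assoc m_closed r_closed s_closed r_inv r_one)
  have "r [^] (- k) \<otimes> r = r [^] (- k + 1)" by (simp only: int_pow_mult int_pow_1 r_closed)
  then have r_pow: "r [^] (- k) \<otimes> (r \<otimes> s) = r [^] (- k + 1) \<otimes> s"
    by (simp flip: m_assoc)
  have "s \<otimes> r [^] (k - 1) = r [^] (- k) \<otimes> (s \<otimes> inv r)"
    using step2 by (simp add: int_pow_diff flip: m_assoc)
  also have "\<dots> = r [^] (- k + 1) \<otimes> s"
    unfolding s_inv by (rule r_pow)
  finally show ?case by simp
qed

text \<open>Moving \<open>s\<close> to the right past a power of \<open>r\<close> inverts that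
  power, and two adjacent copies of \<open>s\<close> merge into \<open>r^c\<close>. These are
  exactly the sign and the summand \<open>c\<close> in the product of the extension.\<close>

lemma hom_from_inverting_extension:
  fixes m c :: int
  assumes r_m: "r [^] m = \<one>" and s_s: "s \<otimes> s = r [^] c" and "m > 0"
  shows "(\<lambda>(i, e). r [^] i \<otimes> (if e then s else \<one>)) \<in> hom (inverting_extension m c) G"
proof (rule homI)
  have pow_mod: "r [^] (i mod m) = r [^] i" for i
  proof -
    have "r [^] i = r [^] (m * (i div m) + i mod m)" by simp
    also have "\<dots> = (r [^] m) [^] (i div m) \<otimes> r [^] (i mod m)"
      by (simp only: int_pow_pow int_pow_mult r_closed)
    finally show ?thesis by (simp add: r_m)
  qed
  fix x y :: "int \<times> bool"
  obtain i d j e where xy: "x = (i, d)" "y = (j, e)" by (cases x; cases y)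
  have s_r_pow: "s \<otimes> r [^] j = inv (r [^] j) \<otimes> s"
    by (simp add: s_int_pow int_pow_neg)
  then have s_r_pow_s: "s \<otimes> (r [^] j \<otimes> s) = inv (r [^] j) \<otimes> r [^] c"
    by (simp flip: m_assoc) (simp add: m_assoc s_s)
  show "(\<lambda>(i, e). r [^] i \<otimes> (if e then s else \<one>)) (x \<otimes>\<^bsub>inverting_extension m c\<^esub> y) =
      (\<lambda>(i, e). r [^] i \<otimes> (if e then s else \<one>)) x \<otimes>
      (\<lambda>(i, e). r [^] i \<otimes> (if e then s else \<one>)) y"
    using s_r_pow s_r_pow_s
    by (auto simp: xy inverting_extension_simps pow_mod int_pow_mult int_pow_diff int_pow_neg m_assoc)
qed auto

end

text \<open>The map \<open>f\<close> comes from the universal property, the map \<open>h\<close>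
  from the normal forms, and they are inverse to each other. The existence of \<open>f\<close> shows
  that the relations do not collapse the group below \<open>2 * m\<close> elements.\<close>

lemma presented_group_iso_inverting_extension:
  fixes R :: "('g word \<times> 'g word) set" and r s :: 'g and m c :: nat
  defines "P \<equiv> presented_group R"
  assumes gens: "UNIV = {r, s}" "r \<noteq> s" and "m > 0" "m dvd 2 * c"
    and r_m: "word_class R (gen r) [^]\<^bsub>P\<^esub> m = \<one>\<^bsub>P\<^esub>"
    and s_s: "word_class R (gen s) \<otimes>\<^bsub>P\<^esub> word_class R (gen s) = word_class R (gen r) [^]\<^bsub>P\<^esub> c"
    and s_r: "word_class R (gen s) \<otimes>\<^bsub>P\<^esub> word_class R (gen r) =
      inv\<^bsub>P\<^esub> word_class R (gen r) \<otimes>\<^bsub>P\<^esub> word_class R (gen s)"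
    and R: "\<And>u v g. g r = (1 mod int m, False) \<Longrightarrow> g s = (0, True) \<Longrightarrow> (u, v) \<in> R \<Longrightarrow>
      word_value (inverting_extension m c) g u = word_value (inverting_extension m c) g v"
  shows "P \<cong> inverting_extension m c"
proof -
  have "int m dvd int (2 * c)" using assms(5) by (simp only: int_dvd_int_iff)
  then interpret M: inverting_extension_params m c
    using assms(4) by unfold_locales simp_all
  interpret P: group P unfolding P_def by (rule group_presented_group)
  interpret P: inverted_element P "word_class R (gen r)" "word_class R (gen s)"
    by unfold_locales (use s_r in \<open>auto simp: P_def carrier_presented_group\<close>)
  \<comment> \<open>For \<open>m = 1\<close> the pair \<open>(1, False)\<close> lies outside the
    carrier, hence the reduction modulo \<open>m\<close>.\<close>
  define g where "g t = (if t = r then (1 mod int m, False) else (0, True))" for t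
  have g: "g r = (1 mod int m, False)" "g s = (0, True)" "range g \<subseteq> carrier M.M"
    using gens M.m_pos by (auto simp: g_def M.M_simps)
  obtain f where f: "f \<in> hom P M.M" "\<And>u. f (word_class R u) = word_value M.M g u"
    using M.hom_from_presented_group[OF g(3) R[OF g(1,2)]] unfolding P_def by blast
  define h where "h = (\<lambda>(i::int, e). word_class R (gen r) [^]\<^bsub>P\<^esub> i \<otimes>\<^bsub>P\<^esub>
    (if e then word_class R (gen s) else \<one>\<^bsub>P\<^esub>))"
  have h: "h \<in> hom M.M P"
    unfolding h_def by (rule P.hom_from_inverting_extension)
      (use r_m s_s assms(4) in \<open>simp_all add: int_pow_int\<close>)
  interpret f: group_hom P M.M f by unfold_locales (rule f)
  interpret h: group_hom M.M P h by unfold_locales (rule h)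
  have f_gen: "f (word_class R (gen t)) = g t" for t
  proof -
    have "g t \<in> carrier M.M" using g(3) by auto
    then show ?thesis using f(2)[of "gen t"] by simp
  qed
  have fh: "f (h p) = p" if "p \<in> carrier M.M" for p
  proof -
    obtain i e where p: "p = (i, e)" by (cases p)
    have "f (word_class R (gen r) [^]\<^bsub>P\<^esub> i) = (i mod int m, False)"
      using M.int_pow_rotation[of 1 i] by (simp add: f.hom_int_pow f_gen g)
    then show ?thesis
      using that by (simp add: p h_def f_gen g M.M_simps split: if_splits)
  qed
  have h_gen: "h (g t) = word_class R (gen t)" for t
  proof -
    have r1: "word_class R (gen r) [^]\<^bsub>P\<^esub> (1 mod int m) = word_class R (gen r)"
    proof (cases "m = 1")
      case True
      then show ?thesis using r_m by simp
    next
      case False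
      then show ?thesis using assms(4) by simp
    qed
    have "h (g r) = word_class R (gen r)" unfolding g h_def by (simp add: r1)
    moreover have "h (g s) = word_class R (gen s)" unfolding g h_def by simp
    moreover have "t = r \<or> t = s" using gens(1) by blast
    ultimately show ?thesis by blast
  qed
  \<comment> \<open>Following \<open>f\<close> by \<open>h\<close> fixes the classes of the
    generators, and so the class of every word.\<close>
  have hf: "h (word_value M.M g u) = word_class R u" for u
  proof (induction u)
    case Nil
    show ?case by (simp add: P_def presented_group_def)
  next
    case (Cons l u)
    have "g (fst l) \<in> carrier M.M" using g(3) by auto
    then show ?case
      unfolding word_class_eq_word_value[of R "l # u"]
      using Cons word_class_eq_word_value[of R u]
      by (simp add: M.word_value_closed[OF g(3)] h_gen flip: P_def)
  qed
  have "f \<in> iso P M.M"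
  proof (rule isoI)
    have "h (f A) = A" if "A \<in> carrier P" for A
      using that hf f(2) by (auto simp: P_def carrier_presented_group)
    then show "bij_betw f (carrier P) (carrier M.M)"
      by (intro bij_betwI[where g = h]) (use fh in auto)
  qed (rule f)
  then show ?thesis by (rule is_isoI)
qed

subsection \<open>The dihedral and the generalised quaternion groups\<close>

lemma dihedral_group_iso:
  assumes "m > 0"
  shows "dihedral_group m \<cong> inverting_extension m 0"
proof -
  define R where "R = {(gen_pow Gen_a m, []), (gen_pow Gen_b 2, []),
    (gen Gen_b @ gen Gen_a @ gen Gen_b, gen_inv Gen_a)}"
  let ?P = "presented_group R"
  interpret P: group ?P by (rule group_presented_group)
  interpret M: inverting_extension_params m 0 using assms by unfold_locales simp_all
  define a b where "a = word_class R (gen Gen_a)" and "b = word_class R (gen Gen_b)"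
  have [simp]: "a \<in> carrier ?P" "b \<in> carrier ?P"
    by (auto simp: a_def b_def carrier_presented_group)
  have range: "range (\<lambda>s. word_class R (gen s)) \<subseteq> carrier ?P"
    by (auto simp: carrier_presented_group)
  have rel: "word_value ?P (\<lambda>s. word_class R (gen s)) u =
      word_value ?P (\<lambda>s. word_class R (gen s)) v" if "(u, v) \<in> R" for u v
    unfolding word_class_eq_word_value[symmetric] word_class_eq_iff
    using that by (rule word_eq.relation)
  have "(gen_pow Gen_a m, []) \<in> R" "(gen_pow Gen_b 2, []) \<in> R"
    "(gen Gen_b @ gen Gen_a @ gen Gen_b, gen_inv Gen_a) \<in> R"
    by (auto simp: R_def)
  from this[THEN rel] have a_m: "a [^]\<^bsub>?P\<^esub> m = \<one>\<^bsub>?P\<^esub>" and b_b: "b \<otimes>\<^bsub>?P\<^esub> b = \<one>\<^bsub>?P\<^esub>"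
    and bab: "b \<otimes>\<^bsub>?P\<^esub> (a \<otimes>\<^bsub>?P\<^esub> b) = inv\<^bsub>?P\<^esub> a"
    by (simp_all add: P.word_value_gen_pow[OF range] numeral_2_eq_2 flip: a_def b_def)
  \<comment> \<open>Multiplying \<open>bab\<close> by \<open>b\<close> on the right leaves
    \<open>ba\<close>, because \<open>b\<close> is an involution.\<close>
  have "b \<otimes>\<^bsub>?P\<^esub> a = b \<otimes>\<^bsub>?P\<^esub> (a \<otimes>\<^bsub>?P\<^esub> b) \<otimes>\<^bsub>?P\<^esub> b"
    by (simp add: P.m_assoc b_b)
  then have ba: "b \<otimes>\<^bsub>?P\<^esub> a = inv\<^bsub>?P\<^esub> a \<otimes>\<^bsub>?P\<^esub> b" by (simp add: bab)
  have "?P \<cong> inverting_extension (int m) (int 0)"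
  proof (rule presented_group_iso_inverting_extension)
    show "UNIV = {Gen_a, Gen_b}" using dihedral_gen.exhaust by blast
    fix u v and g :: "dihedral_gen \<Rightarrow> _"
    assume g: "g Gen_a = (1 mod int m, False)" "g Gen_b = (0, True)" and uv: "(u, v) \<in> R"
    have gr: "range g \<subseteq> carrier M.M"
    proof
      fix x assume "x \<in> range g"
      then obtain t where "x = g t" by auto
      then show "x \<in> carrier M.M" using g assms by (cases t) (auto simp: M.M_simps)
    qed
    have "g Gen_a [^]\<^bsub>M.M\<^esub> m = \<one>\<^bsub>M.M\<^esub>"
      using M.int_pow_rotation[of 1 "int m"] by (simp add: g int_pow_int M.M_simps)
    then show "word_value (inverting_extension (int m) (int 0)) g u =
        word_value (inverting_extension (int m) (int 0)) g v"
      using uv M.inv_rotation[of 1]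
      by (auto simp: R_def M.word_value_gen_pow[OF gr])
        (auto simp: g M.M_simps numeral_2_eq_2 mod_simps)
  qed (use assms a_m b_b ba in \<open>simp_all flip: a_def b_def\<close>)
  then show ?thesis by (simp add: dihedral_group_def R_def)
qed

lemma gen_quaternion_group_iso:
  assumes "n \<ge> 1"
  shows "gen_quaternion_group n \<cong> inverting_extension (2 ^ n) (2 ^ (n - 1))"
proof -
  define R where "R = {(gen_pow Gen_h (2 ^ n), []), (gen_pow Gen_x 2, gen_pow Gen_h (2 ^ (n - 1))),
    (gen_inv Gen_x @ gen Gen_h @ gen Gen_x, gen_inv Gen_h)}"
  let ?P = "presented_group R"
  have two_c: "2 * 2 ^ (n - 1) = (2 ^ n :: int)" "2 * 2 ^ (n - 1) = (2 ^ n :: nat)"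
    using assms by (cases n; simp)+
  interpret P: group ?P by (rule group_presented_group)
  interpret M: inverting_extension_params "2 ^ n" "2 ^ (n - 1)"
    by unfold_locales (use two_c in simp_all)
  define h x where "h = word_class R (gen Gen_h)" and "x = word_class R (gen Gen_x)"
  have [simp]: "h \<in> carrier ?P" "x \<in> carrier ?P"
    by (auto simp: h_def x_def carrier_presented_group)
  have range: "range (\<lambda>s. word_class R (gen s)) \<subseteq> carrier ?P"
    by (auto simp: carrier_presented_group)
  have rel: "word_value ?P (\<lambda>s. word_class R (gen s)) u =
      word_value ?P (\<lambda>s. word_class R (gen s)) v" if "(u, v) \<in> R" for u v
    unfolding word_class_eq_word_value[symmetric] word_class_eq_iff
    using that by (rule word_eq.relation)
  have "(gen_pow Gen_h (2 ^ n), []) \<in> R"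
    "(gen_pow Gen_x 2, gen_pow Gen_h (2 ^ (n - 1))) \<in> R"
    "(gen_inv Gen_x @ gen Gen_h @ gen Gen_x, gen_inv Gen_h) \<in> R"
    by (auto simp: R_def)
  from this[THEN rel] have h_m: "h [^]\<^bsub>?P\<^esub> (2 ^ n :: nat) = \<one>\<^bsub>?P\<^esub>"
    and x_x: "x \<otimes>\<^bsub>?P\<^esub> x = h [^]\<^bsub>?P\<^esub> (2 ^ (n - 1) :: nat)"
    and xhx: "inv\<^bsub>?P\<^esub> x \<otimes>\<^bsub>?P\<^esub> (h \<otimes>\<^bsub>?P\<^esub> x) = inv\<^bsub>?P\<^esub> h"
    by (simp_all add: P.word_value_gen_pow[OF range] numeral_2_eq_2 flip: h_def x_def)
  \<comment> \<open>The presentation conjugates with \<open>inv x\<close> on the left, the extension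
    with it on the right. Both forms are equivalent to \<open>h x h = x\<close>, through which the
    argument passes.\<close>
  have "h \<otimes>\<^bsub>?P\<^esub> x = x \<otimes>\<^bsub>?P\<^esub> inv\<^bsub>?P\<^esub> h"
    by (simp flip: xhx P.m_assoc)
  then have "h \<otimes>\<^bsub>?P\<^esub> x \<otimes>\<^bsub>?P\<^esub> h = x"
    by (simp add: P.m_assoc)
  then have "inv\<^bsub>?P\<^esub> h \<otimes>\<^bsub>?P\<^esub> x = inv\<^bsub>?P\<^esub> h \<otimes>\<^bsub>?P\<^esub> (h \<otimes>\<^bsub>?P\<^esub> x \<otimes>\<^bsub>?P\<^esub> h)" by simp
  then have xh: "x \<otimes>\<^bsub>?P\<^esub> h = inv\<^bsub>?P\<^esub> h \<otimes>\<^bsub>?P\<^esub> x"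
    by (simp flip: P.m_assoc)
  have "?P \<cong> inverting_extension (int (2 ^ n)) (int (2 ^ (n - 1)))"
  proof (rule presented_group_iso_inverting_extension)
    show "UNIV = {Gen_h, Gen_x}" using quaternion_gen.exhaust by blast
    fix u v and g :: "quaternion_gen \<Rightarrow> _"
    assume "g Gen_h = (1 mod int (2 ^ n), False)" and gx: "g Gen_x = (0, True)"
      and uv: "(u, v) \<in> R"
    then have g: "g Gen_h = (1 mod 2 ^ n, False)" "g Gen_x = (0, True)" by simp_all
    have gr: "range g \<subseteq> carrier M.M"
    proof
      fix y assume "y \<in> range g"
      then obtain t where "y = g t" by auto
      then show "y \<in> carrier M.M" using g by (cases t) (simp_all add: inverting_extension_simps)
    qed
    have pow: "g Gen_h [^]\<^bsub>M.M\<^esub> (k::nat) = (int k mod 2 ^ n, False)" for k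
      using M.int_pow_rotation[of 1 "int k"] by (simp only: g int_pow_int) simp
    \<comment> \<open>Unlike the dihedral reflection, \<open>x\<close> is no involution: its square
      is \<open>r^c\<close>, so its inverse is \<open>r^(-c) x\<close>.\<close>
    have inv_x: "inv\<^bsub>M.M\<^esub> (0, True) = ((- (2 ^ (n - 1))) mod 2 ^ n, True)"
      by (rule M.inv_equality) (simp_all add: inverting_extension_simps mod_simps)
    have x_2: "g Gen_x [^]\<^bsub>M.M\<^esub> (2::nat) = (2 ^ (n - 1) mod 2 ^ n, False)"
      by (simp add: g numeral_2_eq_2 inverting_extension_simps)
    consider "u = gen_pow Gen_h (2 ^ n)" "v = []"
      | "u = gen_pow Gen_x 2" "v = gen_pow Gen_h (2 ^ (n - 1))"
      | "u = gen_inv Gen_x @ gen Gen_h @ gen Gen_x" "v = gen_inv Gen_h"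
      using uv unfolding R_def by blast
    then have "word_value M.M g u = word_value M.M g v"
    proof cases
      case 1
      then show ?thesis
        by (simp only: M.word_value_gen_pow[OF gr] pow word_value.simps)
          (simp add: inverting_extension_simps)
    next
      case 2
      then show ?thesis by (simp only: M.word_value_gen_pow[OF gr] pow x_2) simp
    next
      case 3
      then show ?thesis
        by (simp only: g inv_x M.inv_rotation word_value.simps append.simps
            fst_conv snd_conv if_True if_False)
          (simp add: inverting_extension_simps mod_simps mod_summand_simps)
    qed
    then show "word_value (inverting_extension (int (2 ^ n)) (int (2 ^ (n - 1)))) g u =
        word_value (inverting_extension (int (2 ^ n)) (int (2 ^ (n - 1)))) g v"
      by simp
  qed (use h_m x_x xh two_c in \<open>simp_all flip: h_def x_def\<close>)
  then show ?thesis by (simp add: gen_quaternion_group_def R_def)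
qed

subsection \<open>Power graphs and commuting graphs\<close>

lemma power_graph_iso_transfer:
  assumes "group G" "group H" "f \<in> iso G H" "x \<in> carrier G" "y \<in> carrier G"
  shows "(f x, f y) \<in> parcs (power_graph H) \<longleftrightarrow> (x, y) \<in> parcs (power_graph G)"
proof -
  interpret group_hom G H f
    using assms by (auto simp: group_hom_def group_hom_axioms_def iso_def)
  have inj: "f u = f v \<longleftrightarrow> u = v" if "u \<in> carrier G" "v \<in> carrier G" for u v
    using assms(3) that by (auto simp: iso_def bij_betw_def dest: inj_onD)
  show ?thesis
    using assms(4,5) inj by (simp add: power_graph_def flip: hom_int_pow)
qed

lemma commuting_graph_iso_transfer:
  assumes "group G" "group H" "f \<in> iso G H" "x \<in> carrier G" "y \<in> carrier G"
  shows "(f x, f y) \<in> parcs (commuting_graph H) \<longleftrightarrow> (x, y) \<in> parcs (commuting_graph G)"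
proof -
  interpret group_hom G H f
    using assms by (auto simp: group_hom_def group_hom_axioms_def iso_def)
  have inj: "f u = f v \<longleftrightarrow> u = v" if "u \<in> carrier G" "v \<in> carrier G" for u v
    using assms(3) that by (auto simp: iso_def bij_betw_def dest: inj_onD)
  show ?thesis
    using assms(4,5) inj by (simp add: commuting_graph_def flip: hom_mult)
qed

text \<open>Solvability of a linear congruence modulo \<open>p ^ n\<close> is governed by the gcd of
  its coefficient with \<open>p ^ n\<close>. Such gcds are powers of \<open>p\<close>, so of two of
  them one divides the other. This is where the order of the rotation group being a power of 2
  enters.\<close>

lemma multiple_mod_prime_power:
  fixes i j p :: int
  assumes "prime p"
  shows "(\<exists>k. [i = k * j] (mod p ^ n)) \<or> (\<exists>k. [j = k * i] (mod p ^ n))"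
proof -
  obtain a where a: "gcd i (p ^ n) = p ^ a"
    by (rule divides_primepow[OF assms gcd_dvd2[of i "p ^ n"]]) simp
  obtain b where b: "gcd j (p ^ n) = p ^ b"
    by (rule divides_primepow[OF assms gcd_dvd2[of j "p ^ n"]]) simp
  have "\<exists>k. [j' = k * i'] (mod p ^ n)" if "gcd i' (p ^ n) dvd gcd j' (p ^ n)" for i' j'
  proof -
    have "gcd i' (p ^ n) dvd j'" using that by (rule dvd_trans) simp
    then obtain k where "[i' * k = j'] (mod p ^ n)" using cong_solve_dvd_int by blast
    then have "[j' = k * i'] (mod p ^ n)" by (metis cong_sym mult.commute)
    then show ?thesis ..
  qed
  moreover have "p ^ a dvd p ^ b \<or> p ^ b dvd p ^ a"
    by (meson le_imp_power_dvd linear)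
  ultimately show ?thesis using a b by metis
qed

text \<open>In both graphs a rotation \<open>(i, False)\<close> is joined to a reflection \<open>(j, True)\<close> iff
  \<open>c\<close> divides \<open>i\<close>, and two reflections \<open>(i, True)\<close>, \<open>(j, True)\<close> iff \<open>c\<close> divides \<open>i - j\<close>.\<close>

lemma power_graph_eq_commuting_graph:
  assumes "n \<ge> 1"
  shows "power_graph (inverting_extension (2 ^ n) (2 ^ (n - 1))) =
    commuting_graph (inverting_extension (2 ^ n) 0)"
proof -
  define m c :: int where "m = 2 ^ n" and "c = 2 ^ (n - 1)"
  have mc: "m = 2 * c" "c > 0" unfolding m_def c_def using assms by (cases n; simp)+
  interpret Q: inverting_extension_params m c by unfold_locales (use mc in simp_all)
  interpret D: inverting_extension_params m 0 by unfold_locales (use mc in simp_all)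
  have adj: "(\<exists>k::int. x = y [^]\<^bsub>Q.M\<^esub> k \<or> y = x [^]\<^bsub>Q.M\<^esub> k) \<longleftrightarrow>
      x \<otimes>\<^bsub>D.M\<^esub> y = y \<otimes>\<^bsub>D.M\<^esub> x"
    if x: "x \<in> carrier Q.M" and y: "y \<in> carrier Q.M" for x y
  proof -
    have FF: ?thesis if "x = (i, False)" "y = (j, False)" for i j
    proof -
      have ij: "i mod m = i" "j mod m = j" using x y that by (auto simp: Q.M_simps)
      have "\<exists>k. i mod m = (k * j) mod m \<or> j mod m = (k * i) mod m"
        using multiple_mod_prime_power[of 2 i j n] by (auto simp: cong_def m_def)
      then have "\<exists>k::int. x = y [^]\<^bsub>Q.M\<^esub> k \<or> y = x [^]\<^bsub>Q.M\<^esub> k"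
        using ij Q.int_pow_rotation[of i] Q.int_pow_rotation[of j] by (simp add: that)
      then show ?thesis by (simp add: that D.M_simps add.commute)
    qed
    \<comment> \<open>Two dihedral products in opposite order differ by an even number
      \<open>2 * d\<close>; since \<open>m = 2 * c\<close>, they agree modulo \<open>m\<close> iff
      \<open>c\<close> divides \<open>d\<close>.\<close>
    have double: "a mod m = b mod m \<longleftrightarrow> c dvd d" if "a - b = 2 * d" for a b d
      using mc by (simp add: mod_eq_dvd_iff that)
    \<comment> \<open>The indices on the left are those of the odd powers of
      \<open>(j, True)\<close> and, for \<open>j = 0\<close>, those of the even powers of any
      reflection.\<close>
    have multiple: "(\<exists>l. i = (l * c + j) mod m) \<longleftrightarrow> c dvd i - j" if "i mod m = i" for i j
    proof
      assume "\<exists>l. i = (l * c + j) mod m"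
      then obtain l where "i = (l * c + j) mod m" ..
      then have "i mod m = (l * c + j) mod m mod m" by (rule arg_cong)
      then have "m dvd (i - j) - l * c" by (simp add: mod_eq_dvd_iff algebra_simps)
      then have "c dvd (i - j) - l * c" using mc by (auto elim: dvd_trans[rotated])
      then show "c dvd i - j" by (metis dvd_diff_commute dvd_triv_right zdvd_zdiffD)
    next
      assume "c dvd i - j"
      then obtain l where "i - j = c * l" by (auto elim: dvdE)
      then have "i = l * c + j" by (simp add: algebra_simps)
      then show "\<exists>l. i = (l * c + j) mod m" using that by metis
    qed
    have parity: "(\<exists>k. P k) \<longleftrightarrow> (\<exists>l. P (2 * l)) \<or> (\<exists>l. P (2 * l + 1))" for P :: "int \<Rightarrow> bool"
      by (metis evenE oddE)
    have FT: "(\<exists>k::int. (i, False) = (j, True) [^]\<^bsub>Q.M\<^esub> k \<or> (j, True) = (i, False) [^]\<^bsub>Q.M\<^esub> k) \<longleftrightarrow>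
        (i, False) \<otimes>\<^bsub>D.M\<^esub> (j, True) = (j, True) \<otimes>\<^bsub>D.M\<^esub> (i, False)"
      if "(i, False) \<in> carrier Q.M" "(j, True) \<in> carrier Q.M" for i j
    proof -
      have i: "i mod m = i" using that by (auto simp: Q.M_simps)
      \<comment> \<open>Powers of a rotation are rotations, so only one of the two directions can
        occur.\<close>
      have "(\<exists>k::int. (i, False) = (j, True) [^]\<^bsub>Q.M\<^esub> k \<or> (j, True) = (i, False) [^]\<^bsub>Q.M\<^esub> k) \<longleftrightarrow>
          (\<exists>k::int. (i, False) = (j, True) [^]\<^bsub>Q.M\<^esub> k)"
        using Q.int_pow_rotation[of i] i by simp
      also have "\<dots> \<longleftrightarrow> c dvd i"
        using multiple[OF i, of 0] by (subst parity) (simp add: Q.int_pow_reflection[OF that(2)])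
      \<comment> \<open>The two dihedral products have indices \<open>i + j\<close> and
        \<open>j - i\<close>, whose difference is \<open>2 * i\<close>.\<close>
      also have "\<dots> \<longleftrightarrow> (i + j) mod m = (j - i) mod m"
        by (rule double[symmetric]) simp
      finally show ?thesis by (simp add: D.M_simps)
    qed
    have TT: ?thesis if xy: "x = (i, True)" "y = (j, True)" for i j
    proof -
      have ij: "i mod m = i" "j mod m = j" using x y xy by (auto simp: Q.M_simps)
      have pow: "(\<exists>k::int. (i', True) = (j', True) [^]\<^bsub>Q.M\<^esub> k) \<longleftrightarrow> c dvd i' - j'"
        if "(j', True) \<in> carrier Q.M" "i' mod m = i'" for i' j'
        using multiple[OF that(2), of j']
        by (subst parity) (simp add: Q.int_pow_reflection[OF that(1)])
      have "(\<exists>k::int. x = y [^]\<^bsub>Q.M\<^esub> k \<or> y = x [^]\<^bsub>Q.M\<^esub> k) \<longleftrightarrow> c dvd i - j"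
        using pow[of j i] pow[of i j] x y ij by (auto simp: xy ex_disj_distrib dvd_diff_commute)
      also have "\<dots> \<longleftrightarrow> (i - j) mod m = (j - i) mod m"
        by (rule double[symmetric]) simp
      finally show ?thesis by (simp add: xy D.M_simps)
    qed
    obtain i d j e where "x = (i, d)" "y = (j, e)" by (cases x; cases y)
    then show ?thesis
      using FF TT FT[of i j] FT[of j i] x y by (cases d; cases e) (auto simp: eq_commute disj_commute)
  qed
  moreover have "carrier D.M = carrier Q.M" by (simp add: D.M_simps Q.M_simps)
  \<comment> \<open>Both groups live on the same set of pairs, so the graphs are equal
    outright.\<close>
  ultimately have "power_graph Q.M = commuting_graph D.M"
    by (simp add: power_graph_def commuting_graph_def cong: conj_cong)
  then show ?thesis by (simp add: m_def c_def)
qed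

theorem theorem1:
  fixes n :: nat
  assumes "n \<ge> 1"
  shows "digraph_iso
    (with_proj (power_graph (gen_quaternion_group n)))
    (with_proj (commuting_graph (dihedral_group (2 ^ n))))"
proof -
  let ?Q = "inverting_extension (2 ^ n) (2 ^ (n - 1))" and ?D = "inverting_extension (2 ^ n) 0"
  have two_c: "2 * 2 ^ (n - 1) = (2 ^ n :: int)"
    using assms by (cases n) simp_all
  interpret Q: inverting_extension_params "2 ^ n" "2 ^ (n - 1)"
    by unfold_locales (use two_c in simp_all)
  interpret D: inverting_extension_params "2 ^ n" 0 by unfold_locales simp_all
  have groups: "group (gen_quaternion_group n)" "group (dihedral_group (2 ^ n))"
    by (simp_all add: gen_quaternion_group_def dihedral_group_def group_presented_group)
  obtain f where f: "f \<in> iso (gen_quaternion_group n) ?Q"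
    using gen_quaternion_group_iso[OF assms] by (auto simp: is_iso_def)
  have "?D \<cong> dihedral_group (2 ^ n)"
    using dihedral_group_iso[of "2 ^ n"] by (auto intro: group.iso_sym[OF groups(2)])
  then obtain g where g: "g \<in> iso ?D (dihedral_group (2 ^ n))"
    by (auto simp: is_iso_def)
  have f_bij: "bij_betw f (carrier (gen_quaternion_group n)) (carrier ?Q)"
    and g_bij: "bij_betw g (carrier ?D) (carrier (dihedral_group (2 ^ n)))"
    using f g by (simp_all add: iso_def)
  have carrier: "carrier ?Q = carrier ?D" by (simp add: inverting_extension_simps)
  \<comment> \<open>Adjacency is carried by \<open>f\<close> to the quaternion model, read there as
    dihedral commutation, and carried on by \<open>g\<close>.\<close>
  have "(u, v) \<in> parcs (power_graph (gen_quaternion_group n)) \<longleftrightarrow>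
      (g (f u), g (f v)) \<in> parcs (commuting_graph (dihedral_group (2 ^ n)))"
    if uv: "u \<in> carrier (gen_quaternion_group n)" "v \<in> carrier (gen_quaternion_group n)" for u v
  proof -
    have fuv: "f u \<in> carrier ?D" "f v \<in> carrier ?D"
      using uv f_bij carrier by (auto dest: bij_betwE)
    show ?thesis
      using power_graph_iso_transfer[OF groups(1) Q.is_group f uv]
        commuting_graph_iso_transfer[OF D.is_group groups(2) g fuv]
        power_graph_eq_commuting_graph[OF assms] by simp
  qed
  moreover have "bij_betw (g \<circ> f) (carrier (gen_quaternion_group n))
      (carrier (dihedral_group (2 ^ n)))"
    using bij_betw_trans[OF f_bij] g_bij carrier by simp
  moreover have "pair_wf_digraph (power_graph (gen_quaternion_group n))"
    "pair_wf_digraph (commuting_graph (dihedral_group (2 ^ n)))"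
    using pair_bidirected_digraph_power_graph pair_bidirected_digraph_commuting_graph
    by (auto simp: pair_bidirected_digraph_def pair_sym_digraph_def)
  ultimately show ?thesis
    by (subst digraph_iso_with_proj_iff)
      (auto simp: power_graph_def commuting_graph_def comp_def intro!: exI[of _ "g \<circ> f"])
qed

end
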